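(* Let $l\ge 1$ be fixed, and let $a,b\geq1$, $j\geq0$ and $n\ge 1$ be integers with $a+b+1=l(n-j)$. Then $$\sum_{i\geq0}h_{i}\,Q_{n-i,a,j}=\sum_{i\geq0}h_i\,Q_{n-i,b,j},$$ where $h_i$ is the complete homogeneous symmetric function of degree $i$ (with $h_0=1$) and $Q_{m,k,j}$ is the flag Eulerian quasisymmetric function described in the context (with $Q_{m,k,j}=0$ for $m<0$).
   Context: Fix a positive integer $l$ and commuting indeterminates $x_1,x_2,\dots$. Let $\mathcal{B}$ be the alphabet consisting of the letters $u^m$ ($u\in\{1,2,\dots\}$, $m\in\{0,1,\dots,l-1\}$) and the barred letters $\overline{u^0}$ ($u\in\{1,2,\dots\}$). The letter $u^m$ is called $m$-colored; the barred letter $\overline{u^0}$ is called $0$-colored. The absolute value of $u^m$ and of $\overline{u^0}$ is $u$, and the weight of each of these letters is $x_u$. A colored necklace is a circular word over $\mathcal{B}$ (letters placed clockwise on a circle, considered up to rotation) which is primitive (the underlying linear word is not of the form $w'w'\cdots w'$ with at least two copies of a proper subword $w'$) and satisfies: (1) every barred letter is followed (clockwise) by a letter of lesser or equal absolute value; (2) every $0$-colored unbarred letter is followed by a letter of greater or equal absolute value; (3) a necklace of length one does not consist of a single barred letter. A colored ornament is a finite multiset of colored necklaces; its weight $\mathrm{wt}(R)$ is the product of the weights of all its letters. For integers $n,k,j\ge0$, the flag Eulerian quasisymmetric function $Q_{n,k,j}$ is the sum of $\mathrm{wt}(R)$ over all colored ornaments $R$ having $n$ letters in total, exactly $j$ necklaces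 that consist of a single letter of the form $u^0$, and such that $l\cdot(\text{number of barred letters of }R)+\sum_{m=1}^{l-1} m\cdot(\text{number of letters of }R\text{ of the form }u^m)=k$. (By Hyatt's colored ornament interpretation this coincides with the paper's definition of $Q_{n,k,j}$ as a sum of the fixed point colored Eulerian quasisymmetric functions $Q_{n,i,\vec\alpha,\vec\beta}$ over $li+\sum_m m\beta_m=k$, $\alpha_0=j$.) In particular $Q_{0,0,0}=1$. *)

theory Defs
  imports Main "HOL-Library.Multiset"
begin

(* Letters: Let u m is u^m, Bar u is the barred letter \<overline>{u^0}. *)
datatype letter = Let nat nat | Bar nat

fun absv :: "letter \<Rightarrow> nat" where
  "absv (Let u m) = u" | "absv (Bar u) = u"

fun kval :: "nat \<Rightarrow> letter \<Rightarrow> nat" where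
  "kval l (Let u m) = m" | "kval l (Bar u) = l"

fun valid_letter :: "nat \<Rightarrow> letter \<Rightarrow> bool" where
  "valid_letter l (Let u m) = (u \<ge> 1 \<and> m < l)"
| "valid_letter l (Bar u) = (u \<ge> 1)"

definition primitive_word :: "'a list \<Rightarrow> bool" where
  "primitive_word w \<longleftrightarrow> \<not> (\<exists>w' r. r \<ge> 2 \<and> w = concat (replicate r w'))"

definition necklace_word :: "nat \<Rightarrow> letter list \<Rightarrow> bool" where
  "necklace_word l w \<longleftrightarrow> w \<noteq> [] \<and> (\<forall>x\<in>set w. valid_letter l x) \<and> primitive_word w
     \<and> (\<forall>i<length w. (\<forall>u. w ! i = Bar u \<longrightarrow> absv (w ! ((i + 1) mod length w)) \<le> u))
     \<and> (\<forall>i<length w. (\<forall>u. w ! i = Let u 0 \<longrightarrow> absv (w ! ((i + 1) mod length w)) \<ge> u))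
     \<and> (\<forall>u. w \<noteq> [Bar u])"

definition is_necklace :: "nat \<Rightarrow> letter list set \<Rightarrow> bool" where
  "is_necklace l N \<longleftrightarrow> (\<exists>w. necklace_word l w \<and> N = range (\<lambda>r. rotate r w))"

definition rep :: "letter list set \<Rightarrow> letter list" where
  "rep N = (SOME w. w \<in> N)"

definition is_ornament :: "nat \<Rightarrow> letter list set multiset \<Rightarrow> bool" where
  "is_ornament l R \<longleftrightarrow> (\<forall>N\<in>#R. is_necklace l N)"

definition orn_size :: "letter list set multiset \<Rightarrow> nat" where
  "orn_size R = (\<Sum>N\<in>#R. length (rep N))"

definition orn_k :: "nat \<Rightarrow> letter list set multiset \<Rightarrow> nat" where
  "orn_k l R = (\<Sum>N\<in>#R. sum_list (map (kval l) (rep N)))"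

definition orn_j :: "letter list set multiset \<Rightarrow> nat" where
  "orn_j R = size (filter_mset (\<lambda>N. \<exists>u. rep N = [Let u 0]) R)"

(* content: the multiset of variable indices, i.e. the monomial wt(R) *)
definition orn_content :: "letter list set multiset \<Rightarrow> nat multiset" where
  "orn_content R = (\<Sum>N\<in>#R. mset (map absv (rep N)))"

(* Formal power series in x_1, x_2, ... represented by their coefficient functions:
   the monomial \<Prod> x_u^(count \<mu> u) corresponds to the multiset \<mu>. *)
type_synonym series = "nat multiset \<Rightarrow> int"

definition ser_mult :: "series \<Rightarrow> series \<Rightarrow> series" where
  "ser_mult f g \<mu> = (\<Sum>\<rho>\<in>{\<rho>. \<rho> \<subseteq># \<mu>}. f \<rho> * g (\<mu> - \<rho>))"

definition hser :: "nat \<Rightarrow> series" where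
  "hser i \<mu> = (if size \<mu> = i \<and> (\<forall>u\<in>#\<mu>. u \<ge> 1) then 1 else 0)"

definition Qser :: "nat \<Rightarrow> nat \<Rightarrow> nat \<Rightarrow> nat \<Rightarrow> series" where
  "Qser l n k j \<mu> = int (card {R. is_ornament l R \<and> orn_size R = n \<and> orn_k l R = k
      \<and> orn_j R = j \<and> orn_content R = \<mu>})"

end

(* Writing h_i as a sum over multisets of variables, the left-hand side counts pairs (rho, R) of a
   multiset rho and an ornament R with j one-letter necklaces u^0. Exchanging rho with these
   necklaces leaves the number of bars and colors unchanged, so one may instead count pairs in which
   rho has j elements and R is arbitrary, with n - j letters. Lyndon factorization turns ornaments
   into banners (words satisfying the local rules of a necklace and not ending in a barred letter),
   and reversing a banner of length N while complementing its statistics sends the statistic k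
   to l N - 1 - k. *)

theory Submission
  imports Defs "HOL-Library.List_Lexorder"
begin

subsection \<open>Lyndon words\<close>

text \<open>The exchange is needed because reversal does not respect the number of fixed points: for
  \<open>l = 1\<close> it turns \<open>[Let u 0, Let u 0]\<close>, two fixed points, into
  \<open>[Bar u, Let u 0]\<close>, a single necklace of length two. After the exchange the condition
  on j falls on the multiset \<rho> alone, and the ornament is an arbitrary one of content \<mu> -
  \<rho>. The value a + b = l(n - j) - 1 is a sum of complementary statistics: l for each of the n -
  j - 1 steps between neighbours, and l - 1 for the last letter. Everything happens for one fixed
  monomial \<mu>; Lyndon factorization keeps the letters, hence both content and statistic.\<close>

lemma append_less_append_iff [simp]:
  fixes xs :: "'a::linorder list"
  shows "zs @ xs < zs @ ys \<longleftrightarrow> xs < ys"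
  by (induction zs) auto

lemma append_le_append_iff [simp]:
  fixes xs :: "'a::linorder list"
  shows "zs @ xs \<le> zs @ ys \<longleftrightarrow> xs \<le> ys"
  by (induction zs) auto

lemma le_append_self [simp]:
  fixes xs :: "'a::linorder list"
  shows "xs \<le> xs @ ys"
  by (induction xs) auto

text \<open>The comparison is decided either by length after a common prefix or at a first differing
  position; in the latter case it survives any extension of both words.\<close>

lemma less_list_cases:
  fixes xs :: "'a::linorder list"
  assumes "xs < ys"
  shows "(\<exists>zs. ys = xs @ zs) \<or> (\<forall>us vs. xs @ us < ys @ vs)"
  using assms
proof (induction xs arbitrary: ys)
  case (Cons x xs)
  then obtain y ys' where ys: "ys = y # ys'"
    by (cases ys) auto
  then show ?case
    using Cons by auto
qed simp

definition lyndon :: "'a::linorder list \<Rightarrow> bool" where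
  "lyndon w \<longleftrightarrow> w \<noteq> [] \<and> (\<forall>u v. w = u @ v \<longrightarrow> u \<noteq> [] \<longrightarrow> v \<noteq> [] \<longrightarrow> w < v)"

lemma lyndon_le_suffix:
  assumes "lyndon (u @ v)" "v \<noteq> []"
  shows "u @ v \<le> v"
  using assms unfolding lyndon_def by (cases "u = []") (auto intro: less_imp_le)

lemma lyndon_hd_le:
  assumes "lyndon w" "x \<in> set w"
  shows "hd w \<le> x"
proof -
  obtain u v where w: "w = u @ x # v"
    using assms(2) by (metis split_list)
  then have "w \<le> x # v"
    using lyndon_le_suffix assms(1) by blast
  then show ?thesis
    using assms(1) by (cases w) (auto simp: lyndon_def)
qed

text \<open>The one-letter suffix would be a prefix as well, and a prefix is never greater. For
  barred letters this leaves \<open>[Bar u]\<close> as the only Lyndon word with both ends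
  \<open>Bar u\<close>.\<close>

lemma lyndon_hd_eq_last:
  assumes "lyndon w" "hd w = last w"
  shows "w = [last w]"
proof (rule ccontr)
  assume neq: "w \<noteq> [last w]"
  have w: "w \<noteq> []" "w = butlast w @ [last w]"
    using assms(1) by (simp_all add: lyndon_def)
  then have "butlast w \<noteq> []"
    using neq by fastforce
  then have "w < [last w]"
    using assms(1) w unfolding lyndon_def by blast
  then show False
    using assms(2) w(1) by (cases w) auto
qed

lemma lyndon_less_rotation:
  assumes "lyndon (u @ v)" "u \<noteq> []" "v \<noteq> []"
  shows "u @ v < v @ u"
proof -
  have "u @ v < v"
    using assms by (auto simp: lyndon_def)
  then show ?thesis
    by (rule less_le_trans) simp
qed

lemma rotate_split:
  obtains u v where "w = u @ v" "rotate r w = v @ u"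
  by (metis append_take_drop_id rotate_drop_take)

lemma lyndon_le_rotate:
  assumes "lyndon w"
  shows "w \<le> rotate r w"
proof -
  obtain u v where uv: "w = u @ v" "rotate r w = v @ u"
    by (rule rotate_split)
  then show ?thesis
    using lyndon_less_rotation[of u v] assms by (cases "u = [] \<or> v = []") auto
qed

lemma lyndon_primitive:
  assumes "lyndon w"
  shows "primitive_word w"
  unfolding primitive_word_def
proof clarify
  fix w' :: "'a list" and r :: nat
  assume r: "r \<ge> 2" and w: "w = concat (replicate r w')"
  obtain s where s: "r = Suc (Suc s)"
    using r by (metis add_2_eq_Suc le_Suc_ex)
  \<comment> \<open>\<open>?v\<close> is both a proper suffix and a prefix of the power, and a
    prefix cannot exceed the word.\<close>
  let ?v = "concat (replicate (Suc s) w')"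
  have "w' \<noteq> []"
    using assms w by (auto simp: lyndon_def)
  moreover have "w = w' @ ?v"
    by (simp add: w s)
  ultimately have "w < ?v"
    using assms unfolding lyndon_def by (metis append_is_Nil_conv concat.simps(2) replicate_Suc)
  moreover have "w = ?v @ w'"
    unfolding w s by (metis append.right_neutral concat.simps concat_append replicate_Suc replicate_append_same)
  ultimately show False
    by (metis le_append_self not_le)
qed

lemma lyndon_if_min_rotation:
  assumes prim: "primitive_word w" and min: "\<And>r. w \<le> rotate r w"
  shows "lyndon w"
  unfolding lyndon_def
proof (intro conjI allI impI)
  show "w \<noteq> []"
    using prim by (auto simp: primitive_word_def intro: exI[of _ 2])
  fix u v
  assume w: "w = u @ v" and ne: "u \<noteq> []" "v \<noteq> []"
  have rot: "rotate (length u) w = v @ u"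
    by (simp add: w rotate_append)
  \<comment> \<open>Two nonempty words that commute are powers of one word, so primitivity makes the
    minimality strict.\<close>
  have "u @ v \<noteq> v @ u"
  proof
    assume "u @ v = v @ u"
    then obtain n zs where "n > 1" "concat (replicate n zs) = u @ v"
      using comm_append_is_replicate[OF ne] by blast
    then show False
      using prim w unfolding primitive_word_def by (metis Suc_1 Suc_leI)
  qed
  then have less: "u @ v < v @ u"
    using min[of "length u"] w rot by simp
  show "w < v"
  proof (rule ccontr)
    assume "\<not> w < v"
    then have "v < u @ v"
      using w ne by (metis append_self_conv2 linorder_neqE)
    then consider zs where "u @ v = v @ zs" | "\<forall>us vs. v @ us < (u @ v) @ vs"
      using less_list_cases by blast
    then show False
    proof cases
      \<comment> \<open>Here \<open>v\<close> is both a prefix and a suffix of \<open>w\<close>.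
        Cancelling it from \<open>u @ v < v @ u\<close> leaves \<open>zs < u\<close> with equal
        lengths, hence a true difference, and the rotation \<open>zs @ v\<close> beats
        \<open>w\<close>.\<close>
      case 1
      have len: "length zs = length u"
        using arg_cong[OF 1, of length] by simp
      have zu: "zs < u"
        using less unfolding 1 by simp
      then have "\<not> (\<exists>ys. u = zs @ ys)"
        using len by auto
      then have "zs @ v < u @ v"
        using less_list_cases[OF zu] by blast
      moreover have "rotate (length v) w = zs @ v"
        using rotate_append[of v zs] w 1 by simp
      ultimately show False
        using min[of "length v"] w by simp
    next
      case 2
      then have "v @ u < (u @ v) @ []"
        by blast
      then show False
        using less by simp
    qed
  qed
qed

section \<open>Rotation and primitivity\<close>

lemma rotate_inverse:
  obtains s where "rotate s (rotate r w) = w"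
proof
  \<comment> \<open>This shift completes \<open>r\<close> to a multiple of the length.\<close>
  have "length w * r - r + r = length w * r" if "w \<noteq> []"
    using that by (cases w) auto
  then show "rotate (length w * r - r) (rotate r w) = w"
    by (cases "w = []") (simp_all add: rotate_rotate)
qed

lemma range_rotate_rotate:
  "range (\<lambda>s. rotate s (rotate r w)) = range (\<lambda>s. rotate s w)"
proof -
  obtain t where "rotate t (rotate r w) = w"
    by (rule rotate_inverse)
  then have "rotate s w = rotate (s + t) (rotate r w)" for s
    by (metis rotate_rotate)
  then show ?thesis
    by (auto simp: rotate_rotate)
qed

lemma rotate1_concat_replicate:
  "rotate1 (concat (replicate m w)) = concat (replicate m (rotate1 w))"
proof (cases w)
  case (Cons a y)
  have "concat (replicate k (a # y)) @ [a] = a # concat (replicate k (y @ [a]))" for k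
    by (induction k) auto
  then show ?thesis
    using Cons by (cases m) auto
qed (simp add: concat_replicate_trivial)

lemma primitive_word_rotate:
  assumes "primitive_word w"
  shows "primitive_word (rotate r w)"
  unfolding primitive_word_def
proof clarify
  fix w' and m :: nat
  assume m: "m \<ge> 2" and eq: "rotate r w = concat (replicate m w')"
  have "rotate t (concat (replicate m w')) = concat (replicate m (rotate t w'))" for t
    by (induction t) (simp_all add: rotate1_concat_replicate)
  moreover obtain s where "rotate s (rotate r w) = w"
    by (rule rotate_inverse)
  ultimately show False
    using assms m eq unfolding primitive_word_def by metis
qed

lemma ex_lyndon_rotation:
  assumes "primitive_word w"
  obtains r where "lyndon (rotate r w)"
proof -
  let ?N = "range (\<lambda>r. rotate r w)"
  have w: "w \<noteq> []"
    using assms by (auto simp: primitive_word_def intro: exI[of _ 2])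
  have "?N \<subseteq> (\<lambda>r. rotate r w) ` {..<length w}"
  proof clarify
    fix r
    show "rotate r w \<in> (\<lambda>r. rotate r w) ` {..<length w}"
      using w by (intro image_eqI[of _ _ "r mod length w"]) (simp_all flip: rotate_conv_mod)
  qed
  then have fin: "finite ?N"
    using finite_surj by blast
  have "Min ?N \<in> ?N"
    using fin by (intro Min_in) auto
  then obtain r where r: "Min ?N = rotate r w"
    by blast
  have min: "rotate r w \<le> rotate s (rotate r w)" for s
    using fin r by (metis Min_le rangeI rotate_rotate)
  then show ?thesis
    using that lyndon_if_min_rotation[OF primitive_word_rotate[OF assms] min] by blast
qed

lemma lyndon_rotations_inject:
  assumes "lyndon v" "lyndon w"
    and "range (\<lambda>r. rotate r v) = range (\<lambda>r. rotate r w)"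
  shows "v = w"
proof -
  have self: "x \<in> range (\<lambda>r. rotate r x)" for x :: "'a list"
    by (metis id_apply rangeI rotate0)
  obtain r s where "v = rotate r w" "w = rotate s v"
    using self[of v] self[of w] assms(3) by blast
  then show ?thesis
    using lyndon_le_rotate[OF assms(1), of s] lyndon_le_rotate[OF assms(2), of r] by simp
qed

section \<open>Unique factorization into Lyndon words\<close>

lemma lyndon_factors_last_le_suffix:
  fixes ws :: "'a::linorder list list"
  assumes "sorted (rev ws)" "\<forall>v\<in>set ws. lyndon v" "concat ws = s @ t" "t \<noteq> []"
  shows "last ws \<le> t"
  using assms
proof (induction ws arbitrary: s)
  case (Cons v vs)
  \<comment> \<open>The suffix \<open>t\<close> starts inside the first factor \<open>v\<close> or
    among the later ones. In the first case the piece \<open>r\<close> of \<open>v\<close> is at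
    least \<open>v\<close>, by the Lyndon property, and \<open>v\<close> is at least the last
    factor.\<close>
  consider r where "v = s @ r" "t = r @ concat vs" "r \<noteq> []"
    | r where "concat vs = r @ t" 
  proof -
    obtain r where "v = s @ r \<and> r @ concat vs = t \<or> s = v @ r \<and> concat vs = r @ t"
      using Cons.prems(3) by (auto simp: append_eq_append_conv2)
    then show ?thesis
      using that(1)[of r] that(2)[of "[]"] that(2)[of r] by (cases "r = []") auto
  qed
  then show ?case
  proof cases
    case 1
    have "last (v # vs) \<le> v"
      using Cons.prems(1) by (auto simp: sorted_append)
    also have "v \<le> r"
      using Cons.prems(2) 1 lyndon_le_suffix by auto
    also have "r \<le> t"
      using 1 by simp
    finally show ?thesis .
  next
    case 2
    then have "last vs \<le> t"
      using Cons by (simp add: sorted_append)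
    moreover have "vs \<noteq> []"
      using 2 Cons.prems(4) by auto
    ultimately show ?thesis
      by simp
  qed
qed simp

text \<open>The last factor is determined by the word, being its least nonempty suffix.\<close>

lemma lyndon_factorization_unique:
  fixes vs ws :: "'a::linorder list list"
  assumes "sorted (rev vs)" "\<forall>v\<in>set vs. lyndon v"
    and "sorted (rev ws)" "\<forall>w\<in>set ws. lyndon w"
    and "concat vs = concat ws"
  shows "vs = ws"
  using assms
proof (induction vs arbitrary: ws rule: rev_induct)
  case Nil
  then show ?case
    by (cases ws) (auto simp: lyndon_def)
next
  case (snoc v vs)
  have v: "v \<noteq> []"
    using snoc.prems(2) by (auto simp: lyndon_def)
  then have "ws \<noteq> []"
    using snoc.prems(5) by auto
  then obtain xs x where ws: "ws = xs @ [x]"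
    by (metis append_butlast_last_id)
  have x: "x \<noteq> []"
    using snoc.prems(4) ws by (auto simp: lyndon_def)
  have "v \<le> x"
    using lyndon_factors_last_le_suffix[OF snoc.prems(1,2), of "concat xs" x] snoc.prems(5) ws x
    by simp
  moreover have "x \<le> v"
    using lyndon_factors_last_le_suffix[OF snoc.prems(3,4), of "concat vs" v] snoc.prems(5) ws v
    by simp
  ultimately have "v = x"
    by simp
  then show ?case
    using snoc.IH[of xs] snoc.prems ws by simp
qed

text \<open>The last factor has to be the least nonempty suffix; it is split off and the rest is
  factored by induction. The work lies in comparing it with the earlier factors.\<close>

lemma ex_lyndon_factorization:
  fixes w :: "'a::linorder list"
  shows "\<exists>ws. sorted (rev ws) \<and> (\<forall>v\<in>set ws. lyndon v) \<and> concat ws = w"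
proof (induction "length w" arbitrary: w rule: less_induct)
  case less
  show ?case
  proof (cases "w = []")
    case True
    then show ?thesis
      by (intro exI[of _ "[]"]) simp
  next
    case False
    define T where "T = {t. t \<noteq> [] \<and> (\<exists>s. w = s @ t)}"
    have "T \<subseteq> (\<lambda>k. drop k w) ` {..length w}"
    proof
      fix t
      assume "t \<in> T"
      then obtain s where "w = s @ t"
        by (auto simp: T_def)
      then show "t \<in> (\<lambda>k. drop k w) ` {..length w}"
        by (intro image_eqI[of _ _ "length s"]) auto
    qed
    then have fin: "finite T"
      by (rule finite_surj[rotated]) simp
    define m where "m = Min T"
    have "w \<in> T"
      using False by (auto simp: T_def)
    then have "m \<in> T"
      unfolding m_def using fin Min_in by blast
    then obtain w' where w': "w = w' @ m" and m: "m \<noteq> []"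
      by (auto simp: T_def)
    have min: "m \<le> t" if "w = s @ t" "t \<noteq> []" for s t
      unfolding m_def using fin that by (intro Min_le) (auto simp: T_def)
    have lm: "lyndon m"
      unfolding lyndon_def
    proof (intro conjI allI impI m)
      fix u v
      assume "m = u @ v" "u \<noteq> []" "v \<noteq> []"
      moreover from this have "m \<le> v"
        using min[of "w' @ u" v] w' by simp
      ultimately show "m < v"
        by (metis append_self_conv2 order_le_less)
    qed
    have "length w' < length w"
      using w' m by simp
    then obtain ws where ws: "sorted (rev ws)" "\<forall>v\<in>set ws. lyndon v" "concat ws = w'"
      using less by blast
    have "m \<le> v" if v: "v \<in> set ws" for v
    proof -
      let ?x = "last ws"
      have wsne: "ws \<noteq> []"
        using v by auto
      then have x: "ws = butlast ws @ [?x]"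
        by simp
      have xne: "?x \<noteq> []"
        using ws(2) wsne by (auto simp: lyndon_def)
      have "concat ws = concat (butlast ws) @ ?x"
        by (subst x) simp
      then have mle: "m \<le> ?x @ m"
        using min[of "concat (butlast ws)" "?x @ m"] w' ws(3) m by simp
      \<comment> \<open>If \<open>?x < m\<close>, a true difference would make the suffix
        \<open>?x @ m\<close> less than \<open>m\<close>; and if \<open>m = ?x @ r\<close>,
        minimality against that suffix gives \<open>r \<le> m\<close>, while the Lyndon property
        gives \<open>m < r\<close>.\<close>
      have "m \<le> ?x"
      proof (rule ccontr)
        assume "\<not> m \<le> ?x"
        then have xm: "?x < m"
          by simp
        then consider r where "m = ?x @ r" | "\<forall>us vs. ?x @ us < m @ vs"
          using less_list_cases by blast
        then show False
        proof cases
          case 1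
          then have "r \<noteq> []"
            using xm by auto
          then have "m < r"
            using lm 1 xne by (auto simp: lyndon_def)
          moreover have "r \<le> m"
            using mle 1 by (metis append_le_append_iff)
          ultimately show False
            by simp
        next
          case 2
          then have "?x @ m < m @ []"
            by blast
          then show False
            using mle by simp
        qed
      qed
      also have "?x \<le> v"
        using ws(1) v by (subst (asm) x, subst (asm) (2) x) (auto simp: sorted_append)
      finally show ?thesis .
    qed
    then show ?thesis
      using ws lm w' by (intro exI[of _ "ws @ [m]"]) auto
  qed
qed

subsection \<open>Ornaments and banners\<close>

text \<open>Letters of large absolute value come first: the first letter of a Lyndon word then has the
  largest absolute value, so an unbarred \<open>0\<close>-colored last letter may be followed by it.\<close>

instantiation letter :: linorder
begin

fun bar_rank :: "letter \<Rightarrow> nat" where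
  "bar_rank (Let u m) = Suc m" | "bar_rank (Bar u) = 0"

definition less_eq_letter :: "letter \<Rightarrow> letter \<Rightarrow> bool" where
  "x \<le> y \<longleftrightarrow> absv y < absv x \<or> absv x = absv y \<and> bar_rank x \<le> bar_rank y"

definition less_letter :: "letter \<Rightarrow> letter \<Rightarrow> bool" where
  "x < y \<longleftrightarrow> absv y < absv x \<or> absv x = absv y \<and> bar_rank x < bar_rank y"

instance
proof
  fix x y :: letter
  show "x \<le> y \<Longrightarrow> y \<le> x \<Longrightarrow> x = y"
    by (cases x; cases y) (auto simp: less_eq_letter_def)
qed (auto simp: less_eq_letter_def less_letter_def)

end

section \<open>Local rules on linear and circular words\<close>

lemma absv_antimono: "x \<le> y \<Longrightarrow> absv y \<le> absv x"
  by (auto simp: less_eq_letter_def)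

text \<open>This is why barred letters get rank 0. Where a Lyndon word closes up, or two successive
  factors meet, a barred last letter is followed by one no greater in the order and in absolute
  value.\<close>

lemma le_Bar_imp_eq: "x \<le> Bar u \<Longrightarrow> absv x \<le> u \<Longrightarrow> x = Bar u"
  by (cases x) (auto simp: less_eq_letter_def)

definition step :: "letter \<Rightarrow> letter \<Rightarrow> bool" where
  "step x y \<longleftrightarrow> (\<forall>u. x = Bar u \<longrightarrow> absv y \<le> u) \<and> (\<forall>u. x = Let u 0 \<longrightarrow> u \<le> absv y)"

text \<open>The condition on the last letter stands in for the wrap-around step and for the ban on
  \<open>[Bar u]\<close>. The empty word is a banner and matches the empty ornament.\<close>

definition banner :: "nat \<Rightarrow> letter list \<Rightarrow> bool" where
  "banner l w \<longleftrightarrow> (\<forall>x\<in>set w. valid_letter l x) \<and> successively step w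
     \<and> (w \<noteq> [] \<longrightarrow> (\<forall>u. last w \<noteq> Bar u))"

lemma successively_iff_nth:
  "successively P xs \<longleftrightarrow> (\<forall>i. Suc i < length xs \<longrightarrow> P (xs ! i) (xs ! Suc i))"
  by (induction P xs rule: successively.induct) (auto simp: nth_Cons split: nat.splits)

lemma circular_iff_successively:
  assumes "w \<noteq> []"
  shows "(\<forall>i<length w. P (w ! i) (w ! ((i + 1) mod length w)))
    \<longleftrightarrow> successively P w \<and> P (last w) (hd w)"
proof -
  obtain n where n: "length w = Suc n"
    using assms by (cases w) auto
  have "(\<forall>i<length w. P (w ! i) (w ! ((i + 1) mod length w)))
    \<longleftrightarrow> (\<forall>i<n. P (w ! i) (w ! Suc i)) \<and> P (w ! n) (w ! 0)"
    unfolding n less_Suc_eq by (auto simp: mod_less)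
  then show ?thesis
    using assms n by (simp add: successively_iff_nth last_conv_nth hd_conv_nth)
qed

lemma necklace_word_iff:
  "necklace_word l w \<longleftrightarrow> w \<noteq> [] \<and> (\<forall>x\<in>set w. valid_letter l x) \<and> primitive_word w
     \<and> successively step w \<and> step (last w) (hd w) \<and> (\<forall>u. w \<noteq> [Bar u])"
  using circular_iff_successively[of w step]
  unfolding necklace_word_def step_def by blast

lemma necklace_word_rotate:
  assumes "necklace_word l w"
  shows "necklace_word l (rotate r w)"
proof (induction r)
  case (Suc r)
  let ?v = "rotate r w"
  obtain x v where v: "?v = x # v"
    using Suc by (cases ?v) (auto simp: necklace_word_def)
  have "primitive_word (rotate (Suc r) w)"
    using assms primitive_word_rotate unfolding necklace_word_def by blast
  moreover have "successively step (rotate1 (x # v)) \<and> step (last (rotate1 (x # v))) (hd (rotate1 (x # v)))"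
    using Suc unfolding necklace_word_iff v
    by (cases v) (auto simp: successively_append_iff successively_Cons hd_append)
  ultimately show ?case
    using Suc unfolding necklace_word_iff rotate_Suc v by (cases v) auto
qed (use assms in simp)

text \<open>The two notions differ only where the circle closes. There the first letter, being
  least, has the largest absolute value, so the rule for unbarred 0-colored letters is automatic,
  and a barred last letter would force the word \<open>[Bar u]\<close>.\<close>

lemma lyndon_necklace_word_iff:
  assumes "lyndon w"
  shows "necklace_word l w \<longleftrightarrow> banner l w"
proof -
  have w: "w \<noteq> []"
    using assms by (auto simp: lyndon_def)
  have le: "hd w \<le> last w"
    using lyndon_hd_le assms w last_in_set by blast
  show ?thesis
  proof
    assume nw: "necklace_word l w"
    have "last w \<noteq> Bar u" for u
    proof
      assume u: "last w = Bar u"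
      then have "hd w = Bar u"
        using nw le le_Bar_imp_eq[of "hd w" u] by (auto simp: necklace_word_iff step_def)
      then have "w = [Bar u]"
        using lyndon_hd_eq_last[OF assms] u by simp
      then show False
        using nw by (auto simp: necklace_word_iff)
    qed
    then show "banner l w"
      using nw by (auto simp: necklace_word_iff banner_def)
  next
    assume b: "banner l w"
    then have "step (last w) (hd w)"
      using w absv_antimono[OF le] by (auto simp: banner_def step_def)
    moreover have "w \<noteq> [Bar u]" for u
      using b by (auto simp: banner_def)
    ultimately show "necklace_word l w"
      using b w lyndon_primitive[OF assms] by (auto simp: necklace_word_iff banner_def)
  qed
qed

text \<open>A factor ending in \<open>Bar u\<close> would have to be \<open>[Bar u]\<close>, since \<open>Bar u\<close> precedes the other
  letters of absolute value \<open>u\<close>; by monotonicity the next factor would be \<open>[Bar u]\<close> too.\<close>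

lemma banner_concat_iff:
  assumes "sorted (rev ws)" "\<forall>v\<in>set ws. lyndon v"
  shows "banner l (concat ws) \<longleftrightarrow> (\<forall>v\<in>set ws. banner l v)"
  using assms
proof (induction ws)
  case (Cons v vs)
  have IH: "banner l (concat vs) \<longleftrightarrow> (\<forall>v\<in>set vs. banner l v)"
    using Cons by (simp add: sorted_append)
  have v: "lyndon v" "v \<noteq> []"
    using Cons.prems by (auto simp: lyndon_def)
  have hl: "hd v \<le> last v"
    using lyndon_hd_le v last_in_set by blast
  show ?case
  proof (cases vs)
    case Nil
    then show ?thesis
      by simp
  next
    case (Cons x xs)
    have x: "lyndon x" "x \<noteq> []" "x \<le> v"
      using Cons.prems Cons by (auto simp: lyndon_def sorted_append)
    have hd: "hd (concat vs) = hd x" and ne: "concat vs \<noteq> []"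
      using x Cons by auto
    have hh: "hd x \<le> hd v"
      using x v by (cases x; cases v) auto
    have "banner l (v @ concat vs) \<longleftrightarrow> banner l v \<and> banner l (concat vs)"
    proof
      assume b: "banner l (v @ concat vs)"
      then have b2: "banner l (concat vs)"
        using ne by (auto simp: banner_def successively_append_iff)
      have st: "step (last v) (hd x)"
        using b v ne hd by (auto simp: banner_def successively_append_iff)
      have "last v \<noteq> Bar u" for u
      proof
        assume u: "last v = Bar u"
        then have "absv (hd x) \<le> u"
          using st by (auto simp: step_def)
        moreover have "hd x \<le> Bar u"
          using hh hl u by simp
        ultimately have "hd x = Bar u"
          using le_Bar_imp_eq by blast
        then have eq: "hd x = Bar u" "hd v = Bar u"
          using hh hl u by simp_all
        then have "v = [Bar u]"
          using lyndon_hd_eq_last v u by metis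
        then have "x = [Bar u]"
          using x eq by (cases x) auto
        moreover have "banner l x"
          using IH b2 Cons by simp
        ultimately show False
          by (auto simp: banner_def)
      qed
      then show "banner l v \<and> banner l (concat vs)"
        using b b2 by (auto simp: banner_def successively_append_iff)
    next
      assume b: "banner l v \<and> banner l (concat vs)"
      \<comment> \<open>The last letter of \<open>v\<close> is unbarred, and
        \<open>hd x \<le> hd v \<le> last v\<close> keeps the absolute value from dropping at the
        junction.\<close>
      then have "step (last v) (hd x)"
        using absv_antimono[OF hl] absv_antimono[OF hh] v by (auto simp: banner_def step_def)
      then show "banner l (v @ concat vs)"
        using b ne hd by (auto simp: banner_def successively_append_iff)
    qed
    then show ?thesis
      using IH by auto
  qed
qed (simp add: banner_def)

section \<open>Ornaments as decreasing products of Lyndon banners\<close>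

definition circ :: "'a list \<Rightarrow> 'a list set" where
  "circ w = range (\<lambda>r. rotate r w)"

text \<open>A primitive circular word has exactly one Lyndon rotation, and for it the necklace and
  banner conditions coincide.\<close>

lemma bij_betw_circ:
  "bij_betw circ {w. lyndon w \<and> banner l w} {N. is_necklace l N}"
proof (rule bij_betw_imageI)
  show "inj_on circ {w. lyndon w \<and> banner l w}"
    using lyndon_rotations_inject by (auto simp: inj_on_def circ_def)
  show "circ ` {w. lyndon w \<and> banner l w} = {N. is_necklace l N}"
  proof (intro equalityI subsetI)
    fix N
    assume "N \<in> {N. is_necklace l N}"
    then obtain w where w: "necklace_word l w" "N = circ w"
      by (auto simp: is_necklace_def circ_def)
    then obtain r where r: "lyndon (rotate r w)"
      using ex_lyndon_rotation by (auto simp: necklace_word_def)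
    then have "banner l (rotate r w)"
      using lyndon_necklace_word_iff necklace_word_rotate w by blast
    moreover have "N = circ (rotate r w)"
      unfolding w circ_def range_rotate_rotate ..
    ultimately show "N \<in> circ ` {w. lyndon w \<and> banner l w}"
      using r by blast
  next
    fix N
    assume "N \<in> circ ` {w. lyndon w \<and> banner l w}"
    then show "N \<in> {N. is_necklace l N}"
      using lyndon_necklace_word_iff by (auto simp: is_necklace_def circ_def)
  qed
qed

text \<open>\<open>rep\<close> picks an unspecified word of the class, so the statistics are carried
  over through the multiset of its letters.\<close>

lemma rep_circ: "\<exists>r. rep (circ w) = rotate r w"
proof -
  have "rep (circ w) \<in> circ w"
    unfolding rep_def by (rule someI[of _ w]) (metis circ_def id_apply rangeI rotate0)
  then show ?thesis
    by (auto simp: circ_def)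
qed

lemma mset_rotate [simp]: "mset (rotate r w) = mset w"
proof (induction r)
  case (Suc r)
  then show ?case
    by (cases "rotate r w") auto
qed simp

lemma mset_rep_circ [simp]: "mset (rep (circ w)) = mset w"
  using rep_circ[of w] by auto

lemma orn_content_circ:
  "orn_content (image_mset circ (mset ws)) = mset (map absv (concat ws))"
  unfolding orn_content_def by (induction ws) simp_all

lemma orn_k_circ:
  "orn_k l (image_mset circ (mset ws)) = sum_list (map (kval l) (concat ws))"
proof -
  have "sum_list (map (kval l) (rep (circ w))) = sum_list (map (kval l) w)" for w
    by (metis mset_map mset_rep_circ sum_mset_sum_list)
  then show ?thesis
    unfolding orn_k_def by (induction ws) simp_all
qed

lemma size_orn_content: "size (orn_content R) = orn_size R"
  unfolding orn_content_def orn_size_def by (induction R) simp_all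

text \<open>The pivot of the bijection: such a list becomes a word through \<open>concat\<close> and
  a multiset of necklaces by forgetting the order.\<close>

definition lyndon_factors :: "nat \<Rightarrow> letter list list set" where
  "lyndon_factors l = {ws. sorted (rev ws) \<and> (\<forall>v\<in>set ws. lyndon v \<and> banner l v)}"

lemma bij_betw_concat_lyndon_factors:
  "bij_betw concat (lyndon_factors l) {w. banner l w}"
proof (rule bij_betw_imageI)
  show "inj_on concat (lyndon_factors l)"
    using lyndon_factorization_unique by (auto simp: inj_on_def lyndon_factors_def)
  show "concat ` lyndon_factors l = {w. banner l w}"
  proof (intro equalityI subsetI)
    fix w
    assume w: "w \<in> {w. banner l w}"
    obtain ws where ws: "sorted (rev ws)" "\<forall>v\<in>set ws. lyndon v" "concat ws = w"
      using ex_lyndon_factorization by blast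
    then have "ws \<in> lyndon_factors l"
      using w banner_concat_iff[OF ws(1,2), of l] by (auto simp: lyndon_factors_def)
    then show "w \<in> concat ` lyndon_factors l"
      using ws by blast
  qed (auto simp: lyndon_factors_def banner_concat_iff)
qed

lemma bij_betw_circ_lyndon_factors:
  "bij_betw (\<lambda>ws. image_mset circ (mset ws)) (lyndon_factors l) {R. is_ornament l R}"
proof (rule bij_betw_imageI)
  let ?L = "{w. lyndon w \<and> banner l w}"
  let ?g = "inv_into ?L circ"
  have inj: "inj_on circ ?L"
    using bij_betw_circ by (rule bij_betw_imp_inj_on)
  show "inj_on (\<lambda>ws. image_mset circ (mset ws)) (lyndon_factors l)"
  proof (rule inj_onI)
    fix vs ws
    assume vs: "vs \<in> lyndon_factors l" and ws: "ws \<in> lyndon_factors l"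
      and eq: "image_mset circ (mset vs) = image_mset circ (mset ws)"
    \<comment> \<open>Inverting \<open>circ\<close> recovers the multiset of factors, which has a
      single decreasing arrangement.\<close>
    have "image_mset ?g (image_mset circ (mset us)) = mset us" if "us \<in> lyndon_factors l" for us
    proof -
      have "image_mset (?g \<circ> circ) (mset us) = image_mset id (mset us)"
        using that inj by (intro image_mset_cong) (auto simp: lyndon_factors_def inv_into_f_f)
      then show ?thesis
        by (simp add: multiset.map_comp)
    qed
    then have "mset (rev vs) = mset (rev ws)"
      using vs ws eq by (metis mset_rev)
    moreover have "sorted (rev vs)" "sorted (rev ws)"
      using vs ws by (auto simp: lyndon_factors_def)
    ultimately have "rev vs = rev ws"
      by (metis properties_for_sort)
    then show "vs = ws"
      by simp
  qed
  show "(\<lambda>ws. image_mset circ (mset ws)) ` lyndon_factors l = {R. is_ornament l R}"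
  proof (intro equalityI subsetI)
    fix R
    assume "R \<in> {R. is_ornament l R}"
    then have R: "N \<in> circ ` ?L" if "N \<in># R" for N
      using that bij_betw_imp_surj_on[OF bij_betw_circ, of l] by (auto simp: is_ornament_def)
    define ws where "ws = rev (sorted_list_of_multiset (image_mset ?g R))"
    have "image_mset (circ \<circ> ?g) R = image_mset id R"
      using R by (intro image_mset_cong) (auto simp: f_inv_into_f)
    then have "image_mset circ (mset ws) = R"
      by (simp add: ws_def multiset.map_comp)
    moreover have "?g N \<in> ?L" if "N \<in># R" for N
      using R[OF that] by (rule inv_into_into)
    then have "ws \<in> lyndon_factors l"
      by (auto simp: lyndon_factors_def ws_def)
    ultimately show "R \<in> (\<lambda>ws. image_mset circ (mset ws)) ` lyndon_factors l"
      by blast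
  next
    fix R
    assume "R \<in> (\<lambda>ws. image_mset circ (mset ws)) ` lyndon_factors l"
    then show "R \<in> {R. is_ornament l R}"
      using bij_betwE[OF bij_betw_circ, of l]
      by (auto simp: lyndon_factors_def is_ornament_def)
  qed
qed

text \<open>The number of letters is implicit as \<open>size \<mu>\<close>; the number of fixed
  points is left free because the symmetry mixes ornaments with different numbers of them.\<close>

definition ornaments :: "nat \<Rightarrow> nat \<Rightarrow> nat multiset \<Rightarrow> letter list set multiset set" where
  "ornaments l k \<mu> = {R. is_ornament l R \<and> orn_k l R = k \<and> orn_content R = \<mu>}"

definition banners :: "nat \<Rightarrow> nat \<Rightarrow> nat multiset \<Rightarrow> letter list set" where
  "banners l k \<mu> = {w. banner l w \<and> sum_list (map (kval l) w) = k \<and> mset (map absv w) = \<mu>}"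

lemma ex_bij_betw_ornaments_banners:
  "\<exists>f. bij_betw f (ornaments l k \<mu>) (banners l k \<mu>)"
proof -
  let ?W = "{ws \<in> lyndon_factors l. sum_list (map (kval l) (concat ws)) = k
    \<and> mset (map absv (concat ws)) = \<mu>}"
  have "bij_betw concat ?W {w \<in> {w. banner l w}. sum_list (map (kval l) w) = k
    \<and> mset (map absv w) = \<mu>}"
    by (intro bij_betw_Collect bij_betw_concat_lyndon_factors) simp
  moreover have "bij_betw (\<lambda>ws. image_mset circ (mset ws)) ?W
    {R \<in> {R. is_ornament l R}. orn_k l R = k \<and> orn_content R = \<mu>}"
    by (intro bij_betw_Collect bij_betw_circ_lyndon_factors) (simp add: orn_k_circ orn_content_circ)
  ultimately show ?thesis
    unfolding ornaments_def banners_def by (auto dest: bij_betw_inv intro: bij_betw_trans)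
qed

text \<open>A fixed content leaves finitely many letters and one length. Ornaments inherit
  finiteness, on which the count of pairs by fibres relies.\<close>

lemma finite_banners: "finite (banners l k \<mu>)"
proof (rule finite_subset)
  let ?A = "(\<lambda>(u, m). Let u m) ` (set_mset \<mu> \<times> {..<l}) \<union> Bar ` set_mset \<mu>"
  show "banners l k \<mu> \<subseteq> {w. set w \<subseteq> ?A \<and> length w = size \<mu>}"
  proof clarify
    fix w
    assume "w \<in> banners l k \<mu>"
    then have val: "\<forall>x\<in>set w. valid_letter l x" and c: "mset (map absv w) = \<mu>"
      by (auto simp: banners_def banner_def)
    have "absv x \<in># \<mu>" if "x \<in> set w" for x
      using that c by auto
    then have "x \<in> ?A" if "x \<in> set w" for x
      using val that by (cases x) fastforce+
    moreover have "length w = size \<mu>"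
      using c by auto
    ultimately show "set w \<subseteq> ?A \<and> length w = size \<mu>"
      by blast
  qed
  show "finite {w. set w \<subseteq> ?A \<and> length w = size \<mu>}"
    by (intro finite_lists_length_eq) auto
qed

lemma finite_ornaments: "finite (ornaments l k \<mu>)"
  using ex_bij_betw_ornaments_banners bij_betw_finite finite_banners by metis

lemma card_ornaments: "card (ornaments l k \<mu>) = card (banners l k \<mu>)"
  using ex_bij_betw_ornaments_banners bij_betw_same_card by metis

subsection \<open>Symmetry of banners\<close>

text \<open>Coordinates for letters: among those valid for \<open>l\<close>, the value
  \<open>l\<close> belongs to the barred ones alone, since colors stay below
  \<open>l\<close>.\<close>

definition mk_letter :: "nat \<Rightarrow> nat \<Rightarrow> nat \<Rightarrow> letter" where
  "mk_letter l u k = (if k = l then Bar u else Let u k)"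

lemma absv_mk_letter [simp]: "absv (mk_letter l u k) = u"
  by (simp add: mk_letter_def)

lemma kval_mk_letter [simp]: "kval l (mk_letter l u k) = k"
  by (simp add: mk_letter_def)

lemma valid_mk_letter: "k \<le> l \<Longrightarrow> valid_letter l (mk_letter l u k) \<longleftrightarrow> 1 \<le> u"
  by (simp add: mk_letter_def)

lemma mk_letter_absv_kval: "valid_letter l x \<Longrightarrow> mk_letter l (absv x) (kval l x) = x"
  by (cases x) (auto simp: mk_letter_def)

lemma valid_letterD: "valid_letter l x \<Longrightarrow> 1 \<le> absv x \<and> kval l x \<le> l"
  by (cases x) auto

text \<open>In these coordinates a bar is the extreme value \<open>l\<close>, opposite to 0.
  Complementing in \<open>l\<close> exchanges the two local rules, and reading backwards exchanges
  them again. The assumption on \<open>l\<close> keeps the two extremes apart.\<close>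

lemma banner_iff_kval:
  assumes "l \<ge> 1"
  shows "banner l w \<longleftrightarrow> (\<forall>i<length w. valid_letter l (w ! i))
    \<and> (\<forall>i. Suc i < length w \<longrightarrow>
        (kval l (w ! i) = l \<longrightarrow> absv (w ! Suc i) \<le> absv (w ! i)) \<and>
        (kval l (w ! i) = 0 \<longrightarrow> absv (w ! i) \<le> absv (w ! Suc i)))
    \<and> (w \<noteq> [] \<longrightarrow> kval l (w ! (length w - 1)) < l)"
proof -
  have step: "step x y \<longleftrightarrow> (kval l x = l \<longrightarrow> absv y \<le> absv x) \<and> (kval l x = 0 \<longrightarrow> absv x \<le> absv y)"
    if "valid_letter l x" for x y
    using that assms by (cases x) (auto simp: step_def)
  have bar: "(\<forall>u. x \<noteq> Bar u) \<longleftrightarrow> kval l x < l" if "valid_letter l x" for x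
    using that by (cases x) auto
  show ?thesis
    unfolding banner_def all_set_conv_all_nth successively_iff_nth
    by (cases "w = []") (auto simp: step bar last_conv_nth)
qed

text \<open>In a banner the statistic of each letter but the last is constrained only by the step to the
  next letter, with the ranges \<open>0..l-1\<close>, \<open>1..l\<close>, \<open>0..l\<close> for an ascent, a descent and a plateau,
  and that of the last letter lies in \<open>0..l-1\<close>. Reversing the word, each step carries along
  the complement in \<open>l\<close> of its statistic.\<close>

definition reverse_banner :: "nat \<Rightarrow> letter list \<Rightarrow> letter list" where
  "reverse_banner l w = map (\<lambda>i. mk_letter l (absv (w ! (length w - 1 - i)))
     (if Suc i = length w then l - 1 - kval l (w ! i) else l - kval l (w ! (length w - 2 - i))))
     [0..<length w]"

lemma length_reverse_banner [simp]: "length (reverse_banner l w) = length w"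
  by (simp add: reverse_banner_def)

lemma reverse_banner_eq_Nil_iff [simp]: "reverse_banner l w = [] \<longleftrightarrow> w = []"
  by (simp add: reverse_banner_def)

lemma nth_reverse_banner:
  "i < length w \<Longrightarrow> reverse_banner l w ! i = mk_letter l (absv (w ! (length w - 1 - i)))
     (if Suc i = length w then l - 1 - kval l (w ! i) else l - kval l (w ! (length w - 2 - i)))"
  by (simp add: reverse_banner_def)

lemma map_absv_reverse_banner: "map absv (reverse_banner l w) = rev (map absv w)"
  by (rule nth_equalityI) (simp_all add: nth_reverse_banner rev_nth)

lemma banner_reverse_banner:
  assumes "l \<ge> 1" "banner l w"
  shows "banner l (reverse_banner l w)"
proof -
  let ?n = "length w" and ?v = "reverse_banner l w"
  have val: "valid_letter l (w ! i)" if "i < ?n" for i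
    using assms that by (simp add: banner_def)
  have "valid_letter l (?v ! i)" if "i < ?n" for i
    using that val[of "?n - 1 - i"] valid_letterD[of l "w ! (?n - 1 - i)"]
    by (auto simp: nth_reverse_banner valid_mk_letter)
  moreover have "(kval l (?v ! i) = l \<longrightarrow> absv (?v ! Suc i) \<le> absv (?v ! i)) \<and>
        (kval l (?v ! i) = 0 \<longrightarrow> absv (?v ! i) \<le> absv (?v ! Suc i))" if i: "Suc i < ?n" for i
  proof -
    \<comment> \<open>Positions \<open>i\<close> and \<open>Suc i\<close> of the reversed word take
      their absolute values from \<open>Suc k\<close> and \<open>k\<close>, so this is the step at
      \<open>k\<close> read backwards.\<close>
    define k where "k = ?n - 2 - i"
    have k: "Suc k < ?n" "?n - 1 - i = Suc k" "?n - 1 - Suc i = k" "?n - Suc i = Suc k"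
      using i by (auto simp: k_def)
    have v: "absv (?v ! i) = absv (w ! Suc k)" "absv (?v ! Suc i) = absv (w ! k)"
      "kval l (?v ! i) = l - kval l (w ! k)"
      using i k by (simp_all add: nth_reverse_banner flip: k_def)
    have "kval l (w ! k) \<le> l"
      using val[of k] valid_letterD k by auto
    then show ?thesis
      unfolding v using assms k banner_iff_kval[OF assms(1), of w] by auto
  qed
  moreover have "kval l (?v ! (?n - 1)) < l" if "?v \<noteq> []"
    using that assms(1) by (cases w) (auto simp: nth_reverse_banner)
  ultimately show ?thesis
    unfolding banner_iff_kval[OF assms(1)] by auto
qed

lemma reverse_banner_involution:
  assumes "l \<ge> 1" "banner l w"
  shows "reverse_banner l (reverse_banner l w) = w"
proof (rule nth_equalityI)
  fix i
  let ?n = "length w"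
  assume "i < length (reverse_banner l (reverse_banner l w))"
  then have i: "i < ?n"
    by simp
  have val: "valid_letter l (w ! i)"
    using assms i by (simp add: banner_def)
  show "reverse_banner l (reverse_banner l w) ! i = w ! i"
  proof (cases "Suc i = ?n")
    case True
    \<comment> \<open>This bound is what allows the truncated subtraction from \<open>l - 1\<close>
      to be undone.\<close>
    then have "kval l (w ! i) < l"
      using assms banner_iff_kval[OF assms(1), of w] by (metis diff_Suc_1 length_greater_0_conv zero_less_Suc)
    then have "l - 1 - (l - 1 - kval l (w ! i)) = kval l (w ! i)"
      by simp
    moreover have "0 < ?n" "?n - Suc 0 = i"
      using True by auto
    ultimately show ?thesis
      using True i val mk_letter_absv_kval[OF val] by (simp add: nth_reverse_banner)
  next
    case False
    have "?n - 2 - (?n - 2 - i) = i" "?n - 1 - (?n - 1 - i) = i"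
      "?n - 2 - i < ?n" "?n - 1 - i < ?n" "Suc (?n - 2 - i) \<noteq> ?n"
      using i False by auto
    then show ?thesis
      using False i val valid_letterD[OF val] mk_letter_absv_kval[OF val]
      by (simp add: nth_reverse_banner)
  qed
qed simp

lemma sum_kval_reverse_banner:
  assumes "l \<ge> 1" "banner l w" "w \<noteq> []"
  shows "sum_list (map (kval l) (reverse_banner l w)) + sum_list (map (kval l) w) + 1
    = l * length w"
proof -
  obtain m where m: "length w = Suc m"
    using assms(3) by (cases w) auto
  let ?K = "\<lambda>i. kval l (w ! i)"
  have le: "?K i \<le> l" if "i < m" for i
    using that assms(2) m valid_letterD by (auto simp: banner_def)
  have last: "?K m < l"
    using assms m by (auto simp: banner_iff_kval)
  have "sum_list (map (kval l) (reverse_banner l w))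
      = (\<Sum>i<m. l - ?K (m - Suc i)) + (l - 1 - ?K m)"
    by (simp add: sum_list_sum_nth m atLeast0LessThan nth_reverse_banner)
  also have "(\<Sum>i<m. l - ?K (m - Suc i)) = (\<Sum>i<m. l - ?K i)"
    by (rule sum.nat_diff_reindex)
  finally have "sum_list (map (kval l) (reverse_banner l w)) + sum_list (map (kval l) w) + 1
      = (\<Sum>i<m. l - ?K i) + (\<Sum>i<m. ?K i) + (l - 1 - ?K m) + ?K m + 1"
    by (simp add: sum_list_sum_nth m atLeast0LessThan)
  also have "\<dots> = (\<Sum>i<m. (l - ?K i) + ?K i) + l"
    using last by (simp add: sum.distrib)
  also have "(\<Sum>i<m. (l - ?K i) + ?K i) = l * m"
    using le by simp
  finally show ?thesis
    by (simp add: m)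
qed

lemma card_banners_symmetric:
  assumes "l \<ge> 1" "\<mu> \<noteq> {#}" "a + b + 1 = l * size \<mu>"
  shows "card (banners l a \<mu>) = card (banners l b \<mu>)"
proof (rule bij_betw_same_card)
  have map: "reverse_banner l w \<in> banners l d \<mu>"
    if "w \<in> banners l c \<mu>" "c + d + 1 = l * size \<mu>" for c d w
  proof -
    have w: "banner l w" "sum_list (map (kval l) w) = c" "mset (map absv w) = \<mu>"
      using that by (auto simp: banners_def)
    have "w \<noteq> []" "length w = size \<mu>"
      using w(3) assms(2) by auto
    then have "sum_list (map (kval l) (reverse_banner l w)) = d"
      using sum_kval_reverse_banner[OF assms(1) w(1)] w(2) that(2) by simp
    then show ?thesis
      using w assms banner_reverse_banner by (simp add: banners_def map_absv_reverse_banner del: mset_map)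
  qed
  show "bij_betw (reverse_banner l) (banners l a \<mu>) (banners l b \<mu>)"
    using map[of _ a b] map[of _ b a] assms
    by (intro bij_betw_byWitness[where f' = "reverse_banner l"])
      (auto simp: banners_def reverse_banner_involution)
qed

subsection \<open>Exchanging fixed points\<close>

definition fixed_point :: "letter list set \<Rightarrow> bool" where
  "fixed_point N \<longleftrightarrow> (\<exists>u. rep N = [Let u 0])"

definition point :: "nat \<Rightarrow> letter list set" where
  "point u = {[Let u 0]}"

lemma rep_point [simp]: "rep (point u) = [Let u 0]"
  by (simp add: rep_def point_def)

lemma fixed_point_point [simp]: "fixed_point (point u)"
  by (simp add: fixed_point_def)

lemma point_absv_hd_rep:
  assumes "is_necklace l N" "fixed_point N"
  shows "point (absv (hd (rep N))) = N"
proof -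
  obtain w where w: "N = circ w"
    using assms(1) by (auto simp: is_necklace_def circ_def)
  obtain u where u: "rep N = [Let u 0]"
    using assms(2) by (auto simp: fixed_point_def)
  obtain r where "rep N = rotate r w"
    using rep_circ w by blast
  then have "N = circ (rep N)"
    by (simp add: w circ_def range_rotate_rotate)
  then show ?thesis
    unfolding u by (simp add: circ_def point_def)
qed

lemma is_necklace_point:
  assumes "l \<ge> 1" "u \<ge> 1"
  shows "is_necklace l (point u)"
proof -
  have "lyndon [Let u 0]"
    by (auto simp: lyndon_def Cons_eq_append_conv)
  moreover have "banner l [Let u 0]"
    using assms by (simp add: banner_def)
  ultimately have "necklace_word l [Let u 0]"
    using lyndon_necklace_word_iff by blast
  then show ?thesis
    unfolding is_necklace_def point_def by (intro exI[of _ "[Let u 0]"]) auto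
qed

lemma absv_hd_rep_ge_1:
  assumes "is_necklace l N"
  shows "1 \<le> absv (hd (rep N))"
proof -
  obtain w where w: "necklace_word l w" "N = circ w"
    using assms by (auto simp: is_necklace_def circ_def)
  obtain r where "rep N = rotate r w"
    using rep_circ w by blast
  then have "necklace_word l (rep N)"
    using necklace_word_rotate w by simp
  then show ?thesis
    using valid_letterD unfolding necklace_word_def by (meson hd_in_set)
qed

lemma orn_content_union [simp]: "orn_content (R + S) = orn_content R + orn_content S"
  by (simp add: orn_content_def)

lemma orn_k_union [simp]: "orn_k l (R + S) = orn_k l R + orn_k l S"
  by (simp add: orn_k_def)

lemma orn_content_points [simp]: "orn_content (image_mset point \<rho>) = \<rho>"
  unfolding orn_content_def by (induction \<rho>) auto

lemma orn_k_points [simp]: "orn_k l (image_mset point \<rho>) = 0"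
  unfolding orn_k_def by (induction \<rho>) auto

lemma orn_j_eq: "orn_j R = size (filter_mset fixed_point R)"
  unfolding orn_j_def fixed_point_def ..

text \<open>The bound \<open>1 \<le> u\<close> comes from \<open>hser\<close>: indices are natural
  numbers, but the variables start at 1.\<close>

definition pointed_ornaments ::
    "nat \<Rightarrow> nat \<Rightarrow> nat multiset \<Rightarrow> (nat multiset \<times> letter list set multiset) set" where
  "pointed_ornaments l k \<mu> = {(\<rho>, R). (\<forall>u\<in>#\<rho>. 1 \<le> u) \<and> is_ornament l R \<and> orn_k l R = k
     \<and> \<rho> + orn_content R = \<mu>}"

text \<open>Fixed points correspond to elements of \<open>\<rho>\<close> through
  \<open>point\<close>, whose inverse reads off the absolute value; the other necklaces stay put. On
  pairs with an ornament this is an involution trading \<open>size \<rho>\<close> for the number of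
  fixed points.\<close>

definition swap_points ::
    "nat multiset \<times> letter list set multiset \<Rightarrow> nat multiset \<times> letter list set multiset" where
  "swap_points = (\<lambda>(\<rho>, R). (image_mset (\<lambda>N. absv (hd (rep N))) (filter_mset fixed_point R),
     filter_mset (\<lambda>N. \<not> fixed_point N) R + image_mset point \<rho>))"

lemma points_of_fixed_points:
  assumes "is_ornament l R"
  shows "image_mset point (image_mset (\<lambda>N. absv (hd (rep N))) (filter_mset fixed_point R))
    = filter_mset fixed_point R"
proof -
  have "image_mset (point \<circ> (\<lambda>N. absv (hd (rep N)))) (filter_mset fixed_point R)
      = image_mset id (filter_mset fixed_point R)"
    using assms point_absv_hd_rep by (intro image_mset_cong) (auto simp: is_ornament_def)
  then show ?thesis
    by (simp add: multiset.map_comp)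
qed

lemma filter_fixed_point_points [simp]:
  "filter_mset fixed_point (image_mset point \<rho>) = image_mset point \<rho>"
  "filter_mset (\<lambda>N. \<not> fixed_point N) (image_mset point \<rho>) = {#}"
  by (induction \<rho>) auto

lemma swap_points_involution:
  assumes "p \<in> pointed_ornaments l k \<mu>"
  shows "swap_points (swap_points p) = p"
proof -
  obtain \<rho> R where p: "p = (\<rho>, R)" and R: "is_ornament l R"
    using assms by (auto simp: pointed_ornaments_def)
  have "filter_mset (\<lambda>N. \<not> fixed_point N) R + filter_mset fixed_point R = R"
    by (metis multiset_partition add.commute)
  then show ?thesis
    using points_of_fixed_points[OF R]
    by (simp add: p swap_points_def multiset.map_comp comp_def filter_filter_mset)
qed

lemma swap_points_mem:
  assumes "l \<ge> 1" "p \<in> pointed_ornaments l k \<mu>"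
  shows "swap_points p \<in> pointed_ornaments l k \<mu>"
proof -
  obtain \<rho> R where p: "p = (\<rho>, R)"
    by (cases p)
  have \<rho>: "\<forall>u\<in>#\<rho>. 1 \<le> u" and R: "is_ornament l R" and k: "orn_k l R = k"
    and \<mu>: "\<rho> + orn_content R = \<mu>"
    using assms(2) by (auto simp: pointed_ornaments_def p)
  let ?F = "filter_mset fixed_point R" and ?G = "filter_mset (\<lambda>N. \<not> fixed_point N) R"
  let ?\<sigma> = "image_mset (\<lambda>N. absv (hd (rep N))) ?F"
  have F: "?F = image_mset point ?\<sigma>"
    using points_of_fixed_points[OF R] by simp
  have RFG: "R = ?F + ?G"
    by (rule multiset_partition)
  have "orn_content R = ?\<sigma> + orn_content ?G"
    by (subst RFG) (simp only: orn_content_union, subst F, simp)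
  moreover have "orn_k l R = orn_k l ?G"
    by (subst RFG) (simp only: orn_k_union, subst F, simp)
  moreover have "is_ornament l (?G + image_mset point \<rho>)"
    using R \<rho> is_necklace_point[OF assms(1)] by (auto simp: is_ornament_def)
  moreover have "\<forall>u\<in>#?\<sigma>. 1 \<le> u"
    using R absv_hd_rep_ge_1 by (auto simp: is_ornament_def)
  ultimately show ?thesis
    using k \<mu> by (simp add: p swap_points_def pointed_ornaments_def ac_simps)
qed

lemma card_pointed_ornaments_swap:
  assumes "l \<ge> 1"
  shows "card {p \<in> pointed_ornaments l k \<mu>. orn_j (snd p) = j}
    = card {p \<in> pointed_ornaments l k \<mu>. size (fst p) = j}"
proof (rule bij_betw_same_card)
  have "size (fst (swap_points p)) = orn_j (snd p)" "orn_j (snd (swap_points p)) = size (fst p)" for p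
    by (cases p; simp add: swap_points_def orn_j_eq filter_filter_mset)+
  then show "bij_betw swap_points {p \<in> pointed_ornaments l k \<mu>. orn_j (snd p) = j}
      {p \<in> pointed_ornaments l k \<mu>. size (fst p) = j}"
    using swap_points_mem[OF assms] swap_points_involution
    by (intro bij_betw_byWitness[where f' = swap_points]) auto
qed

section \<open>Coefficients of the products as counts of pairs\<close>

lemma finite_submultisets: "finite {\<rho>. \<rho> \<subseteq># (\<mu> :: 'a multiset)}"
proof (induction \<mu>)
  case (add x \<mu>)
  have "{\<rho>. \<rho> \<subseteq># add_mset x \<mu>} \<subseteq> {\<rho>. \<rho> \<subseteq># \<mu>} \<union> add_mset x ` {\<rho>. \<rho> \<subseteq># \<mu>}"
  proof
    fix \<rho>
    assume \<rho>: "\<rho> \<in> {\<rho>. \<rho> \<subseteq># add_mset x \<mu>}"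
    show "\<rho> \<in> {\<rho>. \<rho> \<subseteq># \<mu>} \<union> add_mset x ` {\<rho>. \<rho> \<subseteq># \<mu>}"
    proof (cases "x \<in># \<rho>")
      case True
      then obtain \<rho>' where "\<rho> = add_mset x \<rho>'"
        by (metis multi_member_split)
      then show ?thesis
        using \<rho> by auto
    next
      case False
      then show ?thesis
        using \<rho> subset_eq_diff_conv[of \<rho> "{#x#}" \<mu>] by simp
    qed
  qed
  then show ?case
    using add finite_subset by blast
qed simp

text \<open>The fibre over \<open>\<rho>\<close> consists of ornaments of the remaining content.
  \<open>P\<close> is general so as to serve the condition on fixed points and, after the exchange,
  the one on \<open>size \<rho>\<close>.\<close>

lemma card_pointed_ornaments:
  "card {p \<in> pointed_ornaments l k \<mu>. P (fst p) (snd p)}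
    = (\<Sum>\<rho> | \<rho> \<subseteq># \<mu> \<and> (\<forall>u\<in>#\<rho>. 1 \<le> u). card {R \<in> ornaments l k (\<mu> - \<rho>). P \<rho> R})"
proof -
  let ?S = "{\<rho>. \<rho> \<subseteq># \<mu> \<and> (\<forall>u\<in>#\<rho>. 1 \<le> u)}"
  have "{p \<in> pointed_ornaments l k \<mu>. P (fst p) (snd p)}
      = Sigma ?S (\<lambda>\<rho>. {R \<in> ornaments l k (\<mu> - \<rho>). P \<rho> R})"
    by (auto simp: pointed_ornaments_def ornaments_def subset_mset.add_diff_inverse)
  moreover have "finite ?S"
    using finite_submultisets by (rule finite_subset[rotated]) auto
  ultimately show ?thesis
    by (simp add: card_SigmaI finite_ornaments)
qed

lemma Qser_eq:
  "Qser l m k j \<nu> = (if size \<nu> = m then int (card {R \<in> ornaments l k \<nu>. orn_j R = j}) else 0)"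
proof -
  have "{R. is_ornament l R \<and> orn_size R = m \<and> orn_k l R = k \<and> orn_j R = j \<and> orn_content R = \<nu>}
      = (if size \<nu> = m then {R \<in> ornaments l k \<nu>. orn_j R = j} else {})"
    by (auto simp: ornaments_def simp flip: size_orn_content)
  then show ?thesis
    unfolding Qser_def by simp
qed

lemma sum_hser_Qser:
  "(\<Sum>i\<in>{0..n}. ser_mult (hser i) (Qser l (n - i) k j) \<mu>)
    = (if size \<mu> = n then int (card {p \<in> pointed_ornaments l k \<mu>. orn_j (snd p) = j}) else 0)"
proof -
  let ?S = "{\<rho>. \<rho> \<subseteq># \<mu>}"
  let ?c = "\<lambda>\<rho>. int (card {R \<in> ornaments l k (\<mu> - \<rho>). orn_j R = j})"
  \<comment> \<open>With \<open>i \<le> n\<close> the difference \<open>n - i\<close> is a true one,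
    so the degree of the second factor forces \<open>size \<mu> = n\<close>.\<close>
  have summand: "hser i \<rho> * Qser l (n - i) k j (\<mu> - \<rho>)
      = (if i = size \<rho> then if size \<mu> = n \<and> (\<forall>u\<in>#\<rho>. 1 \<le> u) then ?c \<rho> else 0 else 0)"
    if "i \<le> n" "\<rho> \<subseteq># \<mu>" for i \<rho>
    using that size_mset_mono[OF that(2)] by (auto simp: hser_def Qser_eq size_Diff_submset)
  have "(\<Sum>i\<in>{0..n}. ser_mult (hser i) (Qser l (n - i) k j) \<mu>)
      = (\<Sum>i\<in>{0..n}. \<Sum>\<rho>\<in>?S. if i = size \<rho>
          then if size \<mu> = n \<and> (\<forall>u\<in>#\<rho>. 1 \<le> u) then ?c \<rho> else 0 else 0)"
    unfolding ser_mult_def using summand by (intro sum.cong) auto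
  also have "\<dots> = (\<Sum>\<rho>\<in>?S. \<Sum>i\<in>{0..n}. if i = size \<rho>
          then if size \<mu> = n \<and> (\<forall>u\<in>#\<rho>. 1 \<le> u) then ?c \<rho> else 0 else 0)"
    by (rule sum.swap)
  \<comment> \<open>Each \<open>\<rho>\<close> meets the single index
    \<open>i = size \<rho>\<close>, which lies in the range when
    \<open>size \<mu> = n\<close>.\<close>
  also have "\<dots> = (\<Sum>\<rho>\<in>?S. if size \<mu> = n \<and> (\<forall>u\<in>#\<rho>. 1 \<le> u) then ?c \<rho> else 0)"
    using size_mset_mono by (intro sum.cong) (fastforce simp: sum.delta)+
  also have "\<dots> = (if size \<mu> = n then \<Sum>\<rho> | \<rho> \<subseteq># \<mu> \<and> (\<forall>u\<in>#\<rho>. 1 \<le> u). ?c \<rho> else 0)"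
    using sum.inter_filter[OF finite_submultisets[of \<mu>], of ?c "\<lambda>\<rho>. \<forall>u\<in>#\<rho>. 1 \<le> u"] by simp
  finally show ?thesis
    by (simp add: card_pointed_ornaments[where P = "\<lambda>\<rho> R. orn_j R = j"])
qed

theorem theorem1p1:
  fixes l a b j n :: nat
  assumes "l \<ge> 1" and "a \<ge> 1" and "b \<ge> 1" and "n \<ge> 1"
    and "int (a + b + 1) = int l * (int n - int j)"
  shows "\<forall>\<mu>. (\<Sum>i\<in>{0..n}. ser_mult (hser i) (Qser l (n - i) a j) \<mu>)
            = (\<Sum>i\<in>{0..n}. ser_mult (hser i) (Qser l (n - i) b j) \<mu>)"
proof
  fix \<mu> :: "nat multiset"
  \<comment> \<open>The equation is over the integers, where positivity of its left side excludes
    \<open>j \<ge> n\<close>.\<close>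
  have "0 < int l * (int n - int j)"
    using assms(5) by linarith
  then have jn: "j < n"
    using assms(1) by (simp add: zero_less_mult_iff)
  then have "int (a + b + 1) = int (l * (n - j))"
    using assms(5) by (simp add: of_nat_diff)
  then have ab: "a + b + 1 = l * (n - j)"
    by (simp only: of_nat_eq_iff)
  \<comment> \<open>The condition now concerns \<open>\<rho>\<close> alone: either it fails and both
    sets are empty, or \<open>\<mu> - \<rho>\<close> has \<open>n - j\<close> elements and the
    banner symmetry applies to all ornaments of that content.\<close>
  have card: "card {R \<in> ornaments l a (\<mu> - \<rho>). size \<rho> = j}
      = card {R \<in> ornaments l b (\<mu> - \<rho>). size \<rho> = j}" if "\<rho> \<subseteq># \<mu>" "size \<mu> = n" for \<rho>
  proof (cases "size \<rho> = j")
    case True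
    then have "size (\<mu> - \<rho>) = n - j"
      using that by (simp add: size_Diff_submset)
    moreover from this have "\<mu> - \<rho> \<noteq> {#}"
      using jn by auto
    ultimately show ?thesis
      using True ab card_banners_symmetric[OF assms(1), of "\<mu> - \<rho>" a b]
      by (simp add: card_ornaments)
  qed simp
  have "card {p \<in> pointed_ornaments l a \<mu>. size (fst p) = j}
      = card {p \<in> pointed_ornaments l b \<mu>. size (fst p) = j}" if "size \<mu> = n"
    unfolding card_pointed_ornaments[where P = "\<lambda>\<rho> R. size \<rho> = j"]
    using that card by (intro sum.cong) auto
  then show "(\<Sum>i\<in>{0..n}. ser_mult (hser i) (Qser l (n - i) a j) \<mu>)
      = (\<Sum>i\<in>{0..n}. ser_mult (hser i) (Qser l (n - i) b j) \<mu>)"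
    by (simp add: sum_hser_Qser card_pointed_ornaments_swap[OF assms(1)])
qed

end
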